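(* Let $q$ be a prime power, let $n$ and $r$ be positive integers, let $t_1,\ldots,t_r$ be positive integers and put $\tau=t_1t_2\cdots t_r$. Suppose $\mathcal{C}$ is a family (set) of $r$-multichains in $L_q(n)$ such that $\mathcal{C}_k$ is $t_k$-chain free for each $k\in\{1,\ldots,r\}$. Then $$\sum_{a_1+\cdots+a_{r+1}=n}\frac{|\mathcal{C}_{a_1,\ldots,a_r}|}{\genfrac{[}{]}{0pt}{}{n}{a_1,\ldots,a_{r+1}}_{q}}\le\tau,$$ where the sum is over all $(r+1)$-tuples of non-negative integers $(a_1,\ldots,a_{r+1})$ with $a_1+\cdots+a_{r+1}=n$. Consequently, $$|\mathcal{C}|\le m_1+\cdots+m_\tau,$$ where $m_1,\ldots,m_\tau$ are the $\tau$ largest values of $\genfrac{[}{]}{0pt}{}{n}{a_1,\ldots,a_{r+1}}_{q}$ for non-negative integers $a_1,\ldots,a_{r+1}$ with $a_1+\cdots+a_{r+1}=n$.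
   Context: $\mathbb{F}_q$ is the finite field with $q$ elements and $L_q(n)$ is the lattice of all linear subspaces of $\mathbb{F}_q^n$ ordered by inclusion; the rank of a subspace is its dimension. A chain of length $t$ in $L_q(n)$ is a collection of $t+1$ (distinct) subspaces that are pairwise comparable under inclusion. A family $\mathcal{A}\subseteq L_q(n)$ is $t$-chain free if it contains no chain of length $t$. An $r$-multichain in $L_q(n)$ is an $r$-tuple $(C_1,\ldots,C_r)$ of elements of $L_q(n)$ with $C_1\subseteq\cdots\subseteq C_r$. For a family $\mathcal{C}$ of $r$-multichains, $\mathcal{C}_k=\{C_k\mid(C_1,\ldots,C_k,\ldots,C_r)\in\mathcal{C}\}$ for $k\in\{1,\ldots,r\}$, and for non-negative integers $a_1,\ldots,a_r$ with $a_1+\cdots+a_r\le n$, $\mathcal{C}_{a_1,\ldots,a_r}=\{(C_1,\ldots,C_r)\in\mathcal{C}\mid\dim(C_i)=a_1+\cdots+a_i\text{ for all }i=1,\ldots,r\}$. The $q$-multinomial coefficient is $\genfrac{[}{]}{0pt}{}{n}{a_1,\ldots,a_{r+1}}_{q}=\frac{[n]_q!}{[a_1]_q!\cdots[a_{r+1}]_q!}$, where $[m]_q!=(q^m-1)(q^{m-1}-1)\cdots(q-1)$ and $[0]_q!=1$. The "$\tau$ largest" values are taken from the list of values indexed by all tuples $(a_1,\ldots,a_{r+1})$, i.e. counted with multiplicity (different tuples giving the same value count separately); if $\tau$ exceeds the number of such tuples, the missing $m_i$ are set to $0$. *)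

theory Defs
  imports "HOL-Analysis.Cartesian_Space" "HOL-Library.Multiset"
begin

text \<open>
  The field with \<open>q\<close> elements is a type \<open>'a\<close> of class \<open>{field, finite}\<close> with \<open>CARD('a) = q\<close>, and its
  \<open>n\<close>-th power is \<open>'a ^ 'n\<close> with \<open>CARD('n) = n\<close>. Tuples are lists, so positions \<open>1, \<dots>, r\<close> become
  \<open>0, \<dots>, r - 1\<close>.
\<close>

definition subspace_lattice :: "('a::field ^ 'n::finite) set set" where
  "subspace_lattice = {V. vec.subspace V}"

text \<open>A chain of length \<open>t\<close> has \<open>t + 1\<close> members.\<close>

definition chain_of_length :: "nat \<Rightarrow> ('a::field ^ 'n::finite) set set \<Rightarrow> bool" where
  "chain_of_length t K \<longleftrightarrow> subset.chain subspace_lattice K \<and> card K = t + 1"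

definition chain_free :: "nat \<Rightarrow> ('a::field ^ 'n::finite) set set \<Rightarrow> bool" where
  "chain_free t A \<longleftrightarrow> A \<subseteq> subspace_lattice \<and> \<not> (\<exists>K \<subseteq> A. chain_of_length t K)"

definition multichains :: "nat \<Rightarrow> ('a::field ^ 'n::finite) set list set" where
  "multichains r = {c. length c = r \<and> set c \<subseteq> subspace_lattice \<and> sorted_wrt (\<subseteq>) c}"

definition component :: "'b list set \<Rightarrow> nat \<Rightarrow> 'b set" where
  "component C k = (\<lambda>c. c ! k) ` C"

definition with_dims :: "('a::field ^ 'n::finite) set list set \<Rightarrow> nat list \<Rightarrow>
    ('a ^ 'n) set list set" where
  "with_dims C a = {c \<in> C. \<forall>i < length a. vec.dim (c ! i) = (\<Sum>j\<le>i. a ! j)}"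

definition compositions :: "nat \<Rightarrow> nat \<Rightarrow> nat list set" where
  "compositions k n = {a. length a = k \<and> sum_list a = n}"

text \<open>This factorial is not normalised by a power of \<open>q - 1\<close>; in the multinomial coefficient
  these powers cancel.\<close>

definition q_fact :: "nat \<Rightarrow> nat \<Rightarrow> real" where
  "q_fact q m = (\<Prod>i=1..m. (real q ^ i - 1))"

definition q_multinomial :: "nat \<Rightarrow> nat \<Rightarrow> nat list \<Rightarrow> real" where
  "q_multinomial q n a = q_fact q n / (\<Prod>x\<leftarrow>a. q_fact q x)"

text \<open>The \<open>i\<close>-th largest member of a multiset, counting from \<open>0\<close> and with multiplicity; it is \<open>0\<close>
  once the members are exhausted.\<close>

definition nth_largest :: "real multiset \<Rightarrow> nat \<Rightarrow> real" where
  "nth_largest M i =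
     (if i < size M then rev (sorted_list_of_multiset M) ! i else 0)"

end

theory Submission imports Defs begin

text \<open>
  Ordered bases of the whole space are counted against multichains. The spans of the initial
  segments of an ordered basis form a complete flag, which meets the \<open>k\<close>-th component of the family
  in at most \<open>t k\<close> members, so every ordered basis is adapted to at most \<open>\<tau>\<close> multichains of the
  family. On the other hand, an ordered basis adapted to a given multichain is chosen vector by
  vector: in a block from dimension \<open>k\<close> to dimension \<open>d\<close> there are \<open>q ^ d - q ^ j\<close> choices for
  \<open>k \<le> j < d\<close>. After extracting the powers \<open>q ^ j\<close>, whose product is independent of the multichain,
  the proportion of adapted bases is the reciprocal of the \<open>q\<close>-multinomial coefficient. The bound on
  the cardinality follows since each summand is also at most \<open>1\<close>: a basis is adapted to at most one
  multichain of a given dimension type.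
\<close>

section \<open>Counting vectors and ordered bases\<close>

text \<open>Each vector of the larger span is \<open>k *s b + x\<close> for exactly one scalar
  \<open>k\<close> and one \<open>x\<close> in the smaller span: two different scalars would give a
  nonzero multiple of \<open>b\<close>, hence \<open>b\<close> itself, in
  \<open>vec.span S\<close>.\<close>

lemma card_span_insert:
  fixes S :: "('a::{field,finite} ^ 'n::finite) set"
  assumes "b \<notin> vec.span S"
  shows "card (vec.span (insert b S)) = CARD('a) * card (vec.span S)"
proof -
  let ?f = "\<lambda>(k, x). k *s b + x"
  have "inj_on ?f (UNIV \<times> vec.span S)"
  proof (rule inj_onI, clarify)
    fix k x l y
    assume x: "x \<in> vec.span S" and y: "y \<in> vec.span S" and eq: "k *s b + x = l *s b + y"
    have "(k - l) *s b = y - x"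
      using eq by (simp add: vec.scale_left_diff_distrib algebra_simps)
    moreover have "y - x \<in> vec.span S"
      using x y by (rule vec.span_diff[rotated])
    ultimately have span: "(k - l) *s b \<in> vec.span S" by simp
    have "k - l = 0"
    proof (rule ccontr)
      assume "k - l \<noteq> 0"
      then have "b = inverse (k - l) *s ((k - l) *s b)" by simp
      then show False using assms vec.span_scale[OF span] by metis
    qed
    then show "k = l \<and> x = y" using eq by simp
  qed
  moreover have "?f ` (UNIV \<times> vec.span S) = vec.span (insert b S)"
  proof (intro equalityI subsetI)
    fix z assume "z \<in> ?f ` (UNIV \<times> vec.span S)"
    then obtain k x where "z = k *s b + x" "x \<in> vec.span S" by auto
    then show "z \<in> vec.span (insert b S)"
      by (auto simp: vec.span_breakdown_eq intro!: exI[of _ k])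
  next
    fix z assume "z \<in> vec.span (insert b S)"
    then obtain k where "z - k *s b \<in> vec.span S" by (auto simp: vec.span_breakdown_eq)
    then have "(k, z - k *s b) \<in> UNIV \<times> vec.span S" by simp
    then show "z \<in> ?f ` (UNIV \<times> vec.span S)"
      by (rule rev_image_eqI) simp
  qed
  ultimately have "card (vec.span (insert b S)) = card (UNIV \<times> vec.span S :: ('a \<times> _) set)"
    by (metis card_image)
  then show ?thesis by (simp add: card_cartesian_product)
qed

lemma card_span_independent:
  fixes B :: "('a::{field,finite} ^ 'n::finite) set"
  assumes "vec.independent B"
  shows "card (vec.span B) = CARD('a) ^ card B"
proof -
  have "finite B" by simp
  then show ?thesis using assms
  proof (induction B)
    case empty
    then show ?case by simp
  next
    case (insert b B)
    then show ?case by (simp add: vec.independent_insert card_span_insert)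
  qed
qed

lemma card_subspace:
  fixes V :: "('a::{field,finite} ^ 'n::finite) set"
  assumes "vec.subspace V"
  shows "card V = CARD('a) ^ vec.dim V"
proof -
  obtain B where "B \<subseteq> V" "vec.independent B" "V \<subseteq> vec.span B" "card B = vec.dim V"
    using vec.basis_exists[of V] by blast
  moreover have "vec.span B = V"
    using calculation assms vec.span_minimal by blast
  ultimately show ?thesis using card_span_independent by metis
qed

definition lin_indep_list :: "('a::field ^ 'n::finite) list \<Rightarrow> bool" where
  "lin_indep_list u \<longleftrightarrow> distinct u \<and> vec.independent (set u)"

lemma lin_indep_list_Nil: "lin_indep_list []"
  by (simp add: lin_indep_list_def vec.independent_empty)

lemma lin_indep_list_snoc:
  "lin_indep_list (u @ [x]) \<longleftrightarrow> lin_indep_list u \<and> x \<notin> vec.span (set u)"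
  by (auto simp: lin_indep_list_def vec.independent_insert vec.span_base)

lemma lin_indep_list_append: "lin_indep_list (u @ w) \<Longrightarrow> lin_indep_list u"
  by (auto simp: lin_indep_list_def dest: vec.independent_mono[OF _ Un_upper1])

lemma dim_span_lin_indep_list: "lin_indep_list u \<Longrightarrow> vec.dim (vec.span (set u)) = length u"
  by (simp add: lin_indep_list_def vec.dim_eq_card_independent distinct_card)

text \<open>Only the added vectors are recorded, so that successive blocks can be concatenated. For
  \<open>u = []\<close> and \<open>V = UNIV\<close> these are the ordered bases of the whole
  space.\<close>

definition basis_extensions ::
    "('a::field ^ 'n::finite) list \<Rightarrow> ('a ^ 'n) set \<Rightarrow> ('a ^ 'n) list set" where
  "basis_extensions u V = {w. lin_indep_list (u @ w) \<and> vec.span (set (u @ w)) = V}"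

lemma length_basis_extension:
  assumes "w \<in> basis_extensions u V"
  shows "length u + length w = vec.dim V"
  using assms dim_span_lin_indep_list[of "u @ w"] by (auto simp: basis_extensions_def)

lemma finite_basis_extensions:
  fixes V :: "('a::{field,finite} ^ 'n::finite) set"
  shows "finite (basis_extensions u V)"
proof (rule finite_subset)
  show "basis_extensions u V \<subseteq> {w. set w \<subseteq> UNIV \<and> length w \<le> vec.dim V}"
    using length_basis_extension[of _ u V] by fastforce
qed (rule finite_lists_length_le, simp)

text \<open>After \<open>j\<close> vectors are chosen, the next is any vector of \<open>V\<close>
  outside their span, which has \<open>q ^ j\<close> elements. The induction is on the number of
  vectors still missing.\<close>

lemma card_basis_extensions:
  fixes V :: "('a::{field,finite} ^ 'n::finite) set"
  assumes "vec.subspace V" "lin_indep_list u" "set u \<subseteq> V"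
  shows "card (basis_extensions u V) = (\<Prod>j=length u..<vec.dim V. CARD('a) ^ vec.dim V - CARD('a) ^ j)"
  using assms(2,3)
proof (induction "vec.dim V - length u" arbitrary: u)
  case 0
  \<comment> \<open>Truncated subtraction makes this case say only
    \<open>vec.dim V \<le> length u\<close>. Independence of \<open>u\<close> inside
    \<open>V\<close> gives the converse, so \<open>u\<close> is already a basis of
    \<open>V\<close>.\<close>
  have le: "length u \<le> vec.dim V"
    using 0 vec.dim_subset[of "vec.span (set u)" V] vec.span_minimal[OF _ assms(1)]
    by (metis dim_span_lin_indep_list)
  then have eq: "length u = vec.dim V" using 0 by simp
  have "vec.span (set u) = V"
  proof (rule vec.subspace_dim_equal)
    show "vec.span (set u) \<subseteq> V" by (rule vec.span_minimal[OF "0.prems"(2) assms(1)])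
    show "vec.dim V \<le> vec.dim (vec.span (set u))"
      using dim_span_lin_indep_list[OF "0.prems"(1)] eq by simp
  qed (use assms in auto)
  then have "basis_extensions u V = {[]}"
    using length_basis_extension[of _ u V] eq "0.prems" by (auto simp: basis_extensions_def)
  then show ?case using eq by simp
next
  case (Suc m)
  let ?q = "CARD('a)"
  let ?E = "\<lambda>x. (#) x ` basis_extensions (u @ [x]) V"
  have spanV: "vec.span (set u) \<subseteq> V"
    by (rule vec.span_minimal[OF Suc.prems(2) assms(1)])
  \<comment> \<open>The extensions are split by their first vector; pieces with different heads are
    disjoint.\<close>
  have E: "basis_extensions u V = (\<Union>x\<in>V - vec.span (set u). ?E x)"
  proof (intro equalityI subsetI)
    fix w assume w: "w \<in> basis_extensions u V"
    then have "w \<noteq> []" using length_basis_extension[OF w] Suc.hyps(2) by auto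
    then obtain x w' where ww: "w = x # w'" by (cases w) auto
    have "lin_indep_list (u @ [x])"
      using w ww lin_indep_list_append[of "u @ [x]" w'] by (simp add: basis_extensions_def)
    then have "x \<notin> vec.span (set u)" by (simp add: lin_indep_list_snoc)
    moreover have "x \<in> V" using w ww vec.span_base[of x "set (u @ w)"]
      by (auto simp: basis_extensions_def)
    moreover have "w' \<in> basis_extensions (u @ [x]) V"
      using w ww by (simp add: basis_extensions_def)
    ultimately show "w \<in> (\<Union>x\<in>V - vec.span (set u). ?E x)" using ww by blast
  qed (auto simp: basis_extensions_def)
  have "card (basis_extensions u V) = (\<Sum>x\<in>V - vec.span (set u). card (?E x))"
    unfolding E by (rule card_UN_disjoint) (auto simp: finite_basis_extensions)
  also have "\<dots> = (\<Sum>x\<in>V - vec.span (set u).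
      (\<Prod>j=Suc (length u)..<vec.dim V. ?q ^ vec.dim V - ?q ^ j))"
  proof (rule sum.cong[OF refl])
    fix x assume x: "x \<in> V - vec.span (set u)"
    have "card (?E x) = card (basis_extensions (u @ [x]) V)"
      by (rule card_image) simp
    also have "\<dots> = (\<Prod>j=length (u @ [x])..<vec.dim V. ?q ^ vec.dim V - ?q ^ j)"
      using x Suc.prems Suc.hyps(2) by (intro Suc.hyps(1)) (auto simp: lin_indep_list_snoc)
    finally show "card (?E x) = (\<Prod>j=Suc (length u)..<vec.dim V. ?q ^ vec.dim V - ?q ^ j)"
      by simp
  qed
  also have "\<dots> = card (V - vec.span (set u)) * (\<Prod>j=Suc (length u)..<vec.dim V. ?q ^ vec.dim V - ?q ^ j)"
    by simp
  also have "card (V - vec.span (set u)) = ?q ^ vec.dim V - ?q ^ length u"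
    using spanV card_subspace[OF assms(1)] card_subspace[OF vec.subspace_span, of "set u"]
      dim_span_lin_indep_list[OF Suc.prems(1)] by (simp add: card_Diff_subset)
  also have "\<dots> * (\<Prod>j=Suc (length u)..<vec.dim V. ?q ^ vec.dim V - ?q ^ j) =
      (\<Prod>j=length u..<vec.dim V. ?q ^ vec.dim V - ?q ^ j)"
    using Suc.hyps(2) by (subst prod.atLeast_Suc_lessThan) auto
  finally show ?case .
qed

text \<open>Taking \<open>q ^ j\<close> out of each factor leaves
  \<open>q ^ (k + m - j) - 1\<close>, whose exponents run through \<open>m, ..., 1\<close>. The
  extracted exponents form an interval, so those of consecutive blocks join to a longer
  interval.\<close>

lemma prod_power_diff_eq_q_fact:
  assumes "q > 0"
  shows "real (\<Prod>j=k..<k + m. q ^ (k + m) - q ^ j) = real q ^ (\<Sum>{k..<k + m}) * q_fact q m"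
proof -
  have "real (\<Prod>j=k..<k + m. q ^ (k + m) - q ^ j) =
      (\<Prod>j=k..<k + m. real q ^ j * (real q ^ (k + m - j) - 1))"
    unfolding of_nat_prod
  proof (rule prod.cong[OF refl])
    fix j assume j: "j \<in> {k..<k + m}"
    have "q ^ j \<le> q ^ (k + m)" using j assms by (intro power_increasing) auto
    moreover have "real q ^ (k + m) = real q ^ j * real q ^ (k + m - j)"
      using j by (simp flip: power_add)
    ultimately show "real (q ^ (k + m) - q ^ j) = real q ^ j * (real q ^ (k + m - j) - 1)"
      by (simp add: of_nat_diff algebra_simps)
  qed
  also have "\<dots> = real q ^ (\<Sum>{k..<k + m}) * (\<Prod>j=k..<k + m. real q ^ (k + m - j) - 1)"
    by (simp add: prod.distrib power_sum)
  also have "(\<Prod>j=k..<k + m. real q ^ (k + m - j) - 1) = q_fact q m"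
    unfolding q_fact_def
    by (rule prod.reindex_bij_witness[of _ "\<lambda>i. k + m - i" "\<lambda>j. k + m - j"]) auto
  finally show ?thesis .
qed

section \<open>Bases adapted to a multichain\<close>

text \<open>Here \<open>u\<close> is the part of the basis already chosen, and each block completes
  it to a basis of the next subspace; a repeated subspace contributes an empty block. In
  \<open>adapted [] (c @ [UNIV])\<close> the final \<open>UNIV\<close> makes the result a basis of
  the whole space.\<close>

fun adapted :: "('a::field ^ 'n::finite) list \<Rightarrow> ('a ^ 'n) set list \<Rightarrow> ('a ^ 'n) list set" where
  "adapted u [] = {[]}"
| "adapted u (V # Vs) = (\<Union>w\<in>basis_extensions u V. (@) w ` adapted (u @ w) Vs)"

lemma finite_adapted:
  fixes u :: "('a::{field,finite} ^ 'n::finite) list"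
  shows "finite (adapted u Vs)"
  by (induction Vs arbitrary: u) (auto simp: finite_basis_extensions)

text \<open>The list \<open>a\<close> holds the block sizes. The number of ways to continue depends
  only on dimensions, not on the vectors chosen before, so the counts of the blocks
  multiply.\<close>

lemma card_adapted:
  fixes u :: "('a::{field,finite} ^ 'n::finite) list"
  assumes "lin_indep_list u" "sorted_wrt (\<subseteq>) (vec.span (set u) # Vs)"
    "\<forall>V\<in>set Vs. vec.subspace V" "length a = length Vs"
    "\<forall>i<length Vs. vec.dim (Vs ! i) = length u + sum_list (take (Suc i) a)"
  shows "real (card (adapted u Vs)) =
    real CARD('a) ^ (\<Sum>{length u..<length u + sum_list a}) * (\<Prod>x\<leftarrow>a. q_fact CARD('a) x)"
  using assms
proof (induction Vs arbitrary: u a)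
  case Nil
  then show ?case by simp
next
  case (Cons V Vs)
  let ?q = "CARD('a)"
  obtain x b where a: "a = x # b" and b: "length b = length Vs"
    using Cons.prems(4) by (cases a) auto
  have dimV: "vec.dim V = length u + x"
    using Cons.prems(5) a by (force dest: spec[of _ 0])
  have len: "length w = x" if "w \<in> basis_extensions u V" for w
    using length_basis_extension[OF that] dimV by simp
  let ?c = "real ?q ^ (\<Sum>{length u + x..<length u + x + sum_list b}) * (\<Prod>x\<leftarrow>b. q_fact ?q x)"
  have IH: "real (card ((@) w ` adapted (u @ w) Vs)) = ?c" if w: "w \<in> basis_extensions u V" for w
  proof -
    have "card ((@) w ` adapted (u @ w) Vs) = card (adapted (u @ w) Vs)"
      by (rule card_image) (simp add: inj_on_def)
    also have "real \<dots> = real ?q ^ (\<Sum>{length (u @ w)..<length (u @ w) + sum_list b}) *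
        (\<Prod>x\<leftarrow>b. q_fact ?q x)"
    proof (rule Cons.IH)
      show "lin_indep_list (u @ w)" using w by (simp add: basis_extensions_def)
      show "sorted_wrt (\<subseteq>) (vec.span (set (u @ w)) # Vs)"
        using w Cons.prems(2) by (simp add: basis_extensions_def)
      show "\<forall>i<length Vs. vec.dim (Vs ! i) = length (u @ w) + sum_list (take (Suc i) b)"
        using Cons.prems(5) len[OF w] a by auto
    qed (use Cons.prems b in auto)
    finally show ?thesis using len[OF w] by simp
  qed
  \<comment> \<open>All first blocks have length \<open>x\<close>, so a concatenation determines its
    first block and the union is disjoint.\<close>
  have "card (adapted u (V # Vs)) =
      (\<Sum>w\<in>basis_extensions u V. card ((@) w ` adapted (u @ w) Vs))"
    unfolding adapted.simps
    by (rule card_UN_disjoint) (auto simp: finite_basis_extensions finite_adapted dest!: len)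
  also have "real \<dots> = real (card (basis_extensions u V)) * ?c"
    by (simp add: IH)
  also have "real (card (basis_extensions u V)) =
      real ?q ^ (\<Sum>{length u..<length u + x}) * q_fact ?q x"
  proof -
    have "set u \<subseteq> V" using Cons.prems(2) vec.span_superset[of "set u"] by auto
    then have "card (basis_extensions u V) =
        (\<Prod>j=length u..<length u + x. ?q ^ (length u + x) - ?q ^ j)"
      using card_basis_extensions[of V u] Cons.prems dimV by simp
    then show ?thesis by (simp only:) (rule prod_power_diff_eq_q_fact, simp)
  qed
  also have "real ?q ^ (\<Sum>{length u..<length u + x}) * q_fact ?q x * ?c =
      real ?q ^ (\<Sum>{length u..<length u + sum_list a}) * (\<Prod>x\<leftarrow>a. q_fact ?q x)"
  proof -
    have "\<Sum>{length u..<length u + sum_list a} =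
        \<Sum>{length u..<length u + x} + \<Sum>{length u + x..<length u + x + sum_list b}"
      by (simp add: a add.assoc sum.atLeastLessThan_concat)
    then show ?thesis by (simp add: a power_add)
  qed
  finally show ?case .
qed

lemma adapted_imp_lin_indep_list:
  assumes "lin_indep_list u" "w \<in> adapted u Vs"
  shows "lin_indep_list (u @ w)"
  using assms by (induction Vs arbitrary: u w) (force simp: basis_extensions_def)+

text \<open>The initial segment ending with the block of \<open>V\<close> is a basis of
  \<open>V\<close>, so its length is \<open>vec.dim V\<close>. Thus a basis and a dimension
  determine the subspace, which is what limits the multichains to which one basis is
  adapted.\<close>

lemma adapted_span_take:
  assumes "lin_indep_list u" "w \<in> adapted u Vs" "V \<in> set Vs"
  shows "V = vec.span (set (take (vec.dim V) (u @ w)))"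
  using assms
proof (induction Vs arbitrary: u w)
  case (Cons U Vs)
  then obtain w1 w2 where w: "w = w1 @ w2" "w1 \<in> basis_extensions u U" "w2 \<in> adapted (u @ w1) Vs"
    by auto
  show ?case
  proof (cases "V \<in> set Vs")
    case True
    then show ?thesis using Cons.IH[of "u @ w1" w2] w by (simp add: basis_extensions_def)
  next
    case False
    then have "V = U" using Cons.prems by simp
    moreover have "take (vec.dim U) (u @ w) = u @ w1"
      using length_basis_extension[OF w(2)] w(1) by simp
    ultimately show ?thesis using w(2) by (simp add: basis_extensions_def)
  qed
qed simp

lemma adapted_subset_bases:
  fixes c :: "('a::{field,finite} ^ 'n::finite) set list"
  shows "adapted [] (c @ [UNIV]) \<subseteq> basis_extensions [] UNIV"
proof
  fix w assume w: "w \<in> adapted [] (c @ [UNIV])"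
  have "vec.span (set (take (vec.dim (UNIV :: ('a ^ 'n) set)) w)) = UNIV"
    using adapted_span_take[OF lin_indep_list_Nil w, of UNIV] by simp
  then have "vec.span (set w) = UNIV"
    using vec.span_mono[OF set_take_subset] by (metis top.extremum_uniqueI)
  then show "w \<in> basis_extensions [] UNIV"
    using adapted_imp_lin_indep_list[OF lin_indep_list_Nil w] by (simp add: basis_extensions_def)
qed

section \<open>Dimension types of multichains\<close>

lemma sum_list_take_Suc:
  fixes a :: "nat list"
  assumes "i < length a"
  shows "sum_list (take (Suc i) a) = (\<Sum>j\<le>i. a ! j)"
  using assms by (induction i) (auto simp: take_Suc_conv_app_nth)

text \<open>The last entry of \<open>a\<close> is the codimension of the last member; it enters none
  of the first \<open>r\<close> prefix sums.\<close>

lemma with_dims_butlast_iff: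
  assumes "length a = r + 1"
  shows "c \<in> with_dims C (butlast a) \<longleftrightarrow>
    c \<in> C \<and> (\<forall>i<r. vec.dim (c ! i) = sum_list (take (Suc i) a))"
proof -
  have "sum_list (take (Suc i) a) = (\<Sum>j\<le>i. butlast a ! j)" if "i < r" for i
    using that assms by (subst sum_list_take_Suc) (auto simp: nth_butlast intro!: sum.cong)
  then show ?thesis using assms by (auto simp: with_dims_def)
qed

lemma composition_unique:
  assumes "a \<in> compositions (r + 1) n" "b \<in> compositions (r + 1) n"
    "\<forall>i<r. sum_list (take (Suc i) a) = sum_list (take (Suc i) b)"
  shows "a = b"
proof (rule nth_equalityI)
  show "length a = length b" using assms by (simp add: compositions_def)
  \<comment> \<open>The prefix sum of length \<open>r + 1\<close> is the total \<open>n\<close> on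
    both sides; entries are then differences of consecutive prefix sums.\<close>
  have ps: "sum_list (take i a) = sum_list (take i b)" if "i \<le> r + 1" for i
  proof (cases i)
    case (Suc j)
    then show ?thesis using assms that
      by (cases "j < r") (auto simp: compositions_def dest!: not_less_iff_gr_or_eq[THEN iffD1])
  qed simp
  fix i assume i: "i < length a"
  then have "i < r + 1" "i < length b" using assms by (auto simp: compositions_def)
  then show "a ! i = b ! i"
    using ps[of i] ps[of "Suc i"] i by (simp add: take_Suc_conv_app_nth)
qed

text \<open>The entries of \<open>a\<close> are the gaps between consecutive dimensions, with a last
  gap up to \<open>n\<close>. The offset \<open>k\<close> is the dimension reached so far, which
  varies in the induction.\<close>

lemma composition_exists_aux:
  fixes ds :: "nat list"
  assumes "sorted (k # ds)" "\<forall>d\<in>set (k # ds). d \<le> n"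
  shows "\<exists>a. length a = Suc (length ds) \<and> k + sum_list a = n \<and>
    (\<forall>i<length ds. ds ! i = k + sum_list (take (Suc i) a))"
  using assms
proof (induction ds arbitrary: k)
  case Nil
  then show ?case by (intro exI[of _ "[n - k]"]) simp
next
  case (Cons d ds)
  then obtain a where a: "length a = Suc (length ds)" "d + sum_list a = n"
    "\<forall>i<length ds. ds ! i = d + sum_list (take (Suc i) a)"
    by (metis list.set_intros(2) sorted_simps(2))
  have "k \<le> d" using Cons.prems by simp
  then show ?case using a
    by (intro exI[of _ "(d - k) # a"]) (auto simp: nth_Cons split: nat.split)
qed

lemma composition_exists:
  fixes c :: "('a::field ^ 'n::finite) set list"
  assumes "c \<in> multichains r"
  shows "\<exists>a\<in>compositions (r + 1) CARD('n). \<forall>i<r. vec.dim (c ! i) = sum_list (take (Suc i) a)"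
proof -
  have c: "length c = r" "sorted_wrt (\<subseteq>) c" using assms by (auto simp: multichains_def)
  have "sorted_wrt (\<lambda>x y. vec.dim x \<le> vec.dim y) c"
    using c(2) by (rule sorted_wrt_mono_rel[rotated]) (simp add: vec.dim_subset)
  then have "sorted (0 # map vec.dim c)" by (simp add: sorted_map)
  moreover have "\<forall>d\<in>set (0 # map vec.dim c). d \<le> CARD('n)"
    using vec.dim_subset[OF subset_UNIV] by (auto simp: card_cart_basis)
  ultimately show ?thesis
    using composition_exists_aux[of 0 "map vec.dim c" "CARD('n)"] c(1)
    by (auto simp: compositions_def)
qed

lemma finite_compositions: "finite (compositions k n)"
proof (rule finite_subset)
  show "compositions k n \<subseteq> {a. set a \<subseteq> {..n} \<and> length a = k}"
    using member_le_sum_list by (fastforce simp: compositions_def)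
qed (rule finite_lists_length_eq, simp)

section \<open>The double count\<close>

lemma q_fact_pos: "q > 1 \<Longrightarrow> q_fact q m > 0"
  unfolding q_fact_def by (intro prod_pos) auto

lemma prod_q_fact_pos: "q > 1 \<Longrightarrow> (\<Prod>x\<leftarrow>a. q_fact q x) > 0"
  by (induction a) (simp_all add: q_fact_pos)

lemma q_multinomial_pos: "q > 1 \<Longrightarrow> q_multinomial q n a > 0"
  unfolding q_multinomial_def by (intro divide_pos_pos q_fact_pos prod_q_fact_pos)

lemma card_field_gt_1: "CARD('a::{field,finite}) > 1"
proof -
  have "card {0, 1 :: 'a} \<le> CARD('a)" by (rule card_mono) auto
  then show ?thesis by simp
qed

text \<open>Both counts carry the same power of \<open>q\<close>, with exponent
  \<open>0 + ... + (n - 1)\<close>, so only the factorials remain in the quotient.\<close>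

lemma adapted_proportion:
  fixes c :: "('a::{field,finite} ^ 'n::finite) set list"
  assumes c: "c \<in> multichains r" and a: "a \<in> compositions (r + 1) CARD('n)"
    and dims: "\<forall>i<r. vec.dim (c ! i) = sum_list (take (Suc i) a)"
  shows "real (card (adapted [] (c @ [UNIV]))) =
    real (card (basis_extensions [] (UNIV :: ('a ^ 'n) set))) / q_multinomial CARD('a) CARD('n) a"
proof -
  let ?q = "CARD('a)" and ?n = "CARD('n)"
  have q1: "?q > 1" by (rule card_field_gt_1)
  have len: "length c = r" "length a = r + 1" "sum_list a = ?n"
    using a c by (auto simp: multichains_def compositions_def)
  have sub: "\<forall>V\<in>set c. vec.subspace V" and srt: "sorted_wrt (\<subseteq>) c"
    using c by (auto simp: multichains_def subspace_lattice_def)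
  have 1: "real (card (adapted [] (c @ [UNIV]))) =
      real ?q ^ (\<Sum>{0..<?n}) * (\<Prod>x\<leftarrow>a. q_fact ?q x)"
  proof -
    have "vec.dim ((c @ [UNIV]) ! i) = sum_list (take (Suc i) a)" if "i < Suc r" for i
      using that dims len by (cases "i < r") (auto simp: nth_append card_cart_basis less_Suc_eq)
    then show ?thesis
      using card_adapted[of "[]" "c @ [UNIV]" a] lin_indep_list_Nil sub srt len vec.subspace_0
      by (auto simp: sorted_wrt_append)
  qed
  have 2: "real (card (basis_extensions [] (UNIV :: ('a ^ 'n) set))) =
      real ?q ^ (\<Sum>{0..<?n}) * q_fact ?q ?n"
    using card_basis_extensions[OF vec.subspace_UNIV lin_indep_list_Nil, where 'a='a and 'n='n]
      prod_power_diff_eq_q_fact[of ?q 0 ?n]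
    by (simp add: card_cart_basis)
  show ?thesis
    unfolding 1 2 q_multinomial_def
    using q_fact_pos[OF q1, of ?n] prod_q_fact_pos[OF q1, of a] by (simp add: field_simps)
qed

lemma double_count:
  fixes f :: "'c \<Rightarrow> 'b set"
  assumes "finite D" "finite T" "\<And>c. c \<in> D \<Longrightarrow> f c \<subseteq> T"
    and "\<And>w. w \<in> T \<Longrightarrow> card {c \<in> D. w \<in> f c} \<le> K"
  shows "(\<Sum>c\<in>D. card (f c)) \<le> K * card T"
proof -
  have "(\<Sum>c\<in>D. card (f c)) = (\<Sum>c\<in>D. \<Sum>w\<in>T. if w \<in> f c then 1 else 0)"
    using assms(2,3) by (intro sum.cong) (auto simp: sum.If_cases Int_absorb1)
  also have "\<dots> = (\<Sum>w\<in>T. \<Sum>c\<in>D. if w \<in> f c then 1 else 0)"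
    by (rule sum.swap)
  also have "\<dots> = (\<Sum>w\<in>T. card {c \<in> D. w \<in> f c})"
    using assms(1) by (intro sum.cong) (auto simp: sum.If_cases Int_def)
  also have "\<dots> \<le> (\<Sum>w\<in>T. K)" by (intro sum_mono assms(4))
  finally show ?thesis by (simp add: mult.commute)
qed

lemma finite_multichains: "finite (multichains r :: ('a::{field,finite} ^ 'n::finite) set list set)"
proof (rule finite_subset)
  show "multichains r \<subseteq> {c :: ('a ^ 'n) set list. set c \<subseteq> UNIV \<and> length c = r}"
    by (auto simp: multichains_def)
qed (rule finite_lists_length_eq, simp)

lemma bases_nonempty: "card (basis_extensions [] (UNIV :: ('a::{field,finite} ^ 'n::finite) set)) > 0"
proof -
  obtain B :: "('a ^ 'n) set" where B: "vec.independent B" "UNIV \<subseteq> vec.span B"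
    using vec.basis_exists[of UNIV] by blast
  obtain w where "set w = B" "distinct w"
    using finite_distinct_list[of B] by auto
  then have "w \<in> basis_extensions [] UNIV"
    using B by (auto simp: basis_extensions_def lin_indep_list_def)
  then show ?thesis using finite_basis_extensions card_gt_0_iff by blast
qed

text \<open>Pairs of a multichain and a basis adapted to it are counted, and the result is divided
  by the positive number of bases. It serves twice: for the whole family with
  \<open>K = \<tau>\<close>, and for a single dimension type with \<open>K = 1\<close>.\<close>

lemma sum_adapted_le:
  fixes C :: "('a::{field,finite} ^ 'n::finite) set list set"
  assumes C: "C \<subseteq> multichains r" and D: "D \<subseteq> C"
    and bound: "\<And>w. card {c \<in> D. w \<in> adapted [] (c @ [UNIV])} \<le> K"
    and type: "\<And>c. c \<in> D \<Longrightarrow> T c \<in> compositions (r + 1) CARD('n) \<and>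
      (\<forall>i<r. vec.dim (c ! i) = sum_list (take (Suc i) (T c)))"
  shows "(\<Sum>c\<in>D. 1 / q_multinomial CARD('a) CARD('n) (T c)) \<le> real K"
proof -
  let ?B = "real (card (basis_extensions [] (UNIV :: ('a ^ 'n) set)))"
  have fin: "finite D" using C D finite_multichains finite_subset by metis
  have "real (\<Sum>c\<in>D. card (adapted [] (c @ [UNIV]))) \<le>
      real (K * card (basis_extensions [] (UNIV :: ('a ^ 'n) set)))"
    unfolding of_nat_le_iff
    by (rule double_count[OF fin finite_basis_extensions adapted_subset_bases bound])
  moreover have "real (\<Sum>c\<in>D. card (adapted [] (c @ [UNIV]))) =
      (\<Sum>c\<in>D. ?B * (1 / q_multinomial CARD('a) CARD('n) (T c)))"
    unfolding of_nat_sum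
    using C D by (intro sum.cong refl) (subst adapted_proportion, use type in auto)
  ultimately have "?B * (\<Sum>c\<in>D. 1 / q_multinomial CARD('a) CARD('n) (T c)) \<le> ?B * real K"
    by (simp only: sum_distrib_left of_nat_mult mult.commute)
  then show ?thesis using bases_nonempty[where 'a='a and 'n='n] by simp
qed

section \<open>Multichains to which one basis is adapted\<close>

text \<open>Spans of initial segments of one list are nested, so any \<open>t + 1\<close> members of
  \<open>S\<close> would form a forbidden chain.\<close>

lemma card_flag_chain_free_le:
  fixes w :: "('a::field ^ 'n::finite) list"
  assumes free: "chain_free t A" and S: "S \<subseteq> A"
    and flag: "\<And>V. V \<in> S \<Longrightarrow> V = vec.span (set (take (vec.dim V) w))"
  shows "card S \<le> t"
proof (rule ccontr)
  assume "\<not> card S \<le> t"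
  then have "t + 1 \<le> card S" by simp
  then obtain K where K: "K \<subseteq> S" "card K = t + 1"
    by (rule obtain_subset_with_card_n) auto
  have "V \<subseteq> U \<or> U \<subseteq> V" if "V \<in> K" "U \<in> K" for U V
  proof -
    have "set (take i w) \<subseteq> set (take j w) \<or> set (take j w) \<subseteq> set (take i w)" for i j
      using set_take_subset_set_take[of i j w] set_take_subset_set_take[of j i w] by linarith
    then have "vec.span (set (take i w)) \<subseteq> vec.span (set (take j w)) \<or>
        vec.span (set (take j w)) \<subseteq> vec.span (set (take i w))" for i j
      using vec.span_mono by meson
    moreover have "vec.span (set (take (vec.dim W) w)) = W" if "W \<in> K" for W
      using flag[symmetric] that K(1) by blast
    ultimately show ?thesis using that by metis
  qed
  moreover have "K \<subseteq> subspace_lattice" using K(1) S free by (auto simp: chain_free_def)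
  ultimately have "chain_of_length t K"
    using K(2) by (auto simp: chain_of_length_def subset_chain_def)
  then show False using K(1) S free by (auto simp: chain_free_def)
qed

text \<open>A multichain is determined by its \<open>r\<close> components, and those adapted to
  \<open>w\<close> have at most \<open>t k\<close> possible \<open>k\<close>-th components, all from
  the flag of \<open>w\<close>. Hence they inject into a product of \<open>r\<close> small
  sets.\<close>

lemma card_adapted_multichains_le:
  fixes C :: "('a::{field,finite} ^ 'n::finite) set list set"
  assumes C: "C \<subseteq> multichains r"
    and free: "\<And>k. k < r \<Longrightarrow> chain_free (t k) (component C k)"
  shows "card {c \<in> C. w \<in> adapted [] (c @ [UNIV])} \<le> (\<Prod>k<r. t k)"
proof -
  let ?D = "{c \<in> C. w \<in> adapted [] (c @ [UNIV])}"
  let ?A = "\<lambda>k. (\<lambda>c. c ! k) ` ?D"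
  let ?F = "\<lambda>c. \<lambda>k\<in>{..<r}. c ! k"
  have len: "length c = r" if "c \<in> C" for c using that C by (auto simp: multichains_def)
  have A: "card (?A k) \<le> t k" if k: "k < r" for k
  proof (rule card_flag_chain_free_le[OF free[OF k], of _ w])
    show "?A k \<subseteq> component C k" unfolding component_def by (rule image_mono) blast
    fix V assume "V \<in> ?A k"
    then obtain c where c: "c \<in> C" "w \<in> adapted [] (c @ [UNIV])" "V = c ! k" by blast
    then have "V \<in> set (c @ [UNIV])" using k len by simp
    from adapted_span_take[OF lin_indep_list_Nil c(2) this] show "V = vec.span (set (take (vec.dim V) w))" by simp
  qed
  have fin: "finite (\<Pi>\<^sub>E k\<in>{..<r}. ?A k)"
    by (intro finite_PiE) auto
  have "inj_on ?F ?D"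
  proof (rule inj_onI)
    fix c d assume "c \<in> ?D" "d \<in> ?D" and eq: "?F c = ?F d"
    then have "length c = r" "length d = r" using len by auto
    moreover have "c ! k = d ! k" if "k < r" for k
      using fun_cong[OF eq, of k] that by simp
    ultimately show "c = d" by (intro nth_equalityI) simp_all
  qed
  moreover have "?F ` ?D \<subseteq> (\<Pi>\<^sub>E k\<in>{..<r}. ?A k)" by auto
  ultimately have "card ?D \<le> card (\<Pi>\<^sub>E k\<in>{..<r}. ?A k)"
    using card_inj_on_le fin by blast
  also have "\<dots> = (\<Prod>k<r. card (?A k))" by (simp add: card_PiE)
  also have "\<dots> \<le> (\<Prod>k<r. t k)" by (intro prod_mono) (use A in auto)
  finally show ?thesis .
qed

text \<open>With the dimensions prescribed, every member is the span of an initial segment of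
  \<open>w\<close> of known length.\<close>

lemma card_adapted_same_dims_le:
  fixes D :: "('a::field ^ 'n::finite) set list set"
  assumes "\<And>c. c \<in> D \<Longrightarrow> length c = r \<and> (\<forall>i<r. vec.dim (c ! i) = d i)"
  shows "card {c \<in> D. w \<in> adapted [] (c @ [UNIV])} \<le> 1"
proof -
  have "c = map (\<lambda>i. vec.span (set (take (d i) w))) [0..<r]"
    if c: "c \<in> D" "w \<in> adapted [] (c @ [UNIV])" for c
  proof (rule nth_equalityI)
    fix i assume i: "i < length c"
    then have "c ! i \<in> set (c @ [UNIV])" by simp
    from adapted_span_take[OF lin_indep_list_Nil c(2) this]
    show "c ! i = map (\<lambda>i. vec.span (set (take (d i) w))) [0..<r] ! i"
      using i assms[OF c(1)] by simp
  qed (use assms[OF c(1)] in simp)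
  then have "{c \<in> D. w \<in> adapted [] (c @ [UNIV])} \<subseteq>
      {map (\<lambda>i. vec.span (set (take (d i) w))) [0..<r]}" by auto
  from card_mono[OF _ this] show ?thesis by simp
qed

section \<open>Sums of largest values\<close>

text \<open>A fractional knapsack bound: with weights in \<open>[0, 1]\<close> of total at most
  \<open>k\<close>, nothing beats weight \<open>1\<close> on the \<open>k\<close> largest
  values.\<close>

lemma sum_weighted_le_sum_nth_largest:
  fixes f x :: "'b \<Rightarrow> real"
  assumes fin: "finite A" and f: "\<And>a. a \<in> A \<Longrightarrow> f a \<ge> 0"
    and x: "\<And>a. a \<in> A \<Longrightarrow> 0 \<le> x a \<and> x a \<le> 1" and sum: "sum x A \<le> real k"
  shows "(\<Sum>a\<in>A. x a * f a) \<le> (\<Sum>i<k. nth_largest (image_mset f (mset_set A)) i)"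
proof -
  obtain ys where ys: "set ys = A" "distinct ys" using finite_distinct_list[OF fin] by auto
  \<comment> \<open>Sorting by the negated value lists \<open>A\<close> in decreasing order of
    \<open>f\<close>, matching the reversal in \<open>nth_largest\<close>.\<close>
  define xs where "xs = sort_key (\<lambda>a. - f a) ys"
  have xs: "set xs = A" "distinct xs" "mset xs = mset_set A"
    using ys mset_set_set[of ys] by (auto simp: xs_def)
  have desc: "f (xs ! j) \<le> f (xs ! i)" if "i \<le> j" "j < length xs" for i j
    using sorted_nth_mono[OF sorted_sort_key[of "\<lambda>a. - f a" ys, folded xs_def], of i j] that by simp
  have "sort (rev (map f xs)) = rev (map f xs)"
    by (rule sorted_sort_id) (auto simp: sorted_rev_iff_nth_mono intro: desc)
  moreover have "image_mset f (mset_set A) = mset (rev (map f xs))" using xs(3) by simp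
  ultimately have "sorted_list_of_multiset (image_mset f (mset_set A)) = rev (map f xs)"
    by (simp only: sorted_list_of_multiset_mset)
  moreover have "size (image_mset f (mset_set A)) = length xs"
    by (simp flip: xs(3))
  ultimately have largest: "nth_largest (image_mset f (mset_set A)) i =
      (if i < length xs then f (xs ! i) else 0)" for i
    by (simp add: nth_largest_def)
  have reindex: "(\<Sum>a\<in>A. g a) = (\<Sum>i<length xs. g (xs ! i))" for g :: "'b \<Rightarrow> real"
    using sum.reindex_bij_betw[OF bij_betw_nth[OF xs(2) refl xs(1)[symmetric]], of g] by simp
  have x': "0 \<le> x (xs ! i) \<and> x (xs ! i) \<le> 1" "0 \<le> f (xs ! i)" if "i < length xs" for i
    using x f that xs(1) by (metis nth_mem)+
  show ?thesis
  proof (cases "length xs \<le> k")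
    case True
    \<comment> \<open>All values may get weight \<open>1\<close>; the terms of
      \<open>nth_largest\<close> beyond the last value are \<open>0\<close>.\<close>
    have "(\<Sum>a\<in>A. x a * f a) \<le> (\<Sum>i<length xs. f (xs ! i))"
      unfolding reindex by (intro sum_mono) (use x' in \<open>auto intro: mult_left_le_one_le\<close>)
    also have "\<dots> = (\<Sum>i<k. nth_largest (image_mset f (mset_set A)) i)"
      using True by (intro sum.mono_neutral_cong_left) (auto simp: largest)
    finally show ?thesis .
  next
    case False
    \<comment> \<open>Subtracting \<open>m\<close> makes the first \<open>k\<close> values nonnegative and the others nonpositive,
      so weight \<open>1\<close> is optimal on the former and \<open>0\<close> on the latter.\<close>
    define m where "m = f (xs ! k)"
    have "(\<Sum>i<length xs. x (xs ! i) * (f (xs ! i) - m)) \<le>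
        (\<Sum>i<length xs. if i < k then f (xs ! i) - m else 0)"
    proof (rule sum_mono)
      fix i assume "i \<in> {..<length xs}"
      then have i: "i < length xs" by simp
      show "x (xs ! i) * (f (xs ! i) - m) \<le> (if i < k then f (xs ! i) - m else 0)"
      proof (cases "i < k")
        case True
        then have "f (xs ! i) - m \<ge> 0" using desc[of i k] False by (simp add: m_def)
        then show ?thesis using x'(1)[OF i] True by (simp add: mult_left_le_one_le)
      next
        case ge: False
        then have "f (xs ! i) - m \<le> 0" using desc[of k i] i by (simp add: m_def)
        then show ?thesis using x'(1)[OF i] ge by (simp add: mult_nonneg_nonpos)
      qed
    qed
    also have "\<dots> = (\<Sum>i<k. f (xs ! i) - m)"
      using False by (intro sum.mono_neutral_cong_right) auto
    also have "\<dots> = (\<Sum>i<k. f (xs ! i)) - real k * m"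
      by (simp add: sum_subtractf)
    finally have 1: "(\<Sum>i<length xs. x (xs ! i) * (f (xs ! i) - m)) \<le>
        (\<Sum>i<k. f (xs ! i)) - real k * m" .
    have "(\<Sum>a\<in>A. x a * f a) = (\<Sum>i<length xs. x (xs ! i) * (f (xs ! i) - m)) + sum x A * m"
      unfolding reindex by (simp add: sum_distrib_right right_diff_distrib flip: sum.distrib)
    \<comment> \<open>This uses \<open>m \<ge> 0\<close>, which holds because \<open>m\<close> is a
      value of \<open>f\<close>.\<close>
    also have "sum x A * m \<le> real k * m"
      using sum x'(2)[of k] False by (intro mult_right_mono) (auto simp: m_def)
    finally have "(\<Sum>a\<in>A. x a * f a) \<le> (\<Sum>i<k. f (xs ! i))" using 1 by simp
    also have "\<dots> = (\<Sum>i<k. nth_largest (image_mset f (mset_set A)) i)"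
      using False by (intro sum.cong) (auto simp: largest)
    finally show ?thesis .
  qed
qed

section \<open>The weighted sum and the bound on the cardinality\<close>

theorem theorem4p2:
  fixes C :: "('a::{field,finite} ^ 'n::finite) set list set"
    and q n r \<tau> :: nat and t :: "nat \<Rightarrow> nat"
  assumes "q = CARD('a)" and "n = CARD('n)"
    and "r > 0"
    and "\<And>k. k < r \<Longrightarrow> t k > 0"
    and "\<tau> = (\<Prod>k<r. t k)"
    and "C \<subseteq> multichains r"
    and "\<And>k. k < r \<Longrightarrow> chain_free (t k) (component C k)"
  shows "(\<Sum>a \<in> compositions (r + 1) n.
            real (card (with_dims C (butlast a))) / q_multinomial q n a) \<le> real \<tau>
       \<and> real (card C) \<le> (\<Sum>i<\<tau>. nth_largest
            (image_mset (q_multinomial q n) (mset_set (compositions (r + 1) n))) i)"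
proof -
  let ?M = "q_multinomial q n" and ?P = "compositions (r + 1) n"
  let ?C = "\<lambda>a. with_dims C (butlast a)"
  have Mpos: "?M a > 0" for a
    unfolding assms(1) by (rule q_multinomial_pos[OF card_field_gt_1])
  have iff: "c \<in> ?C a \<longleftrightarrow> c \<in> C \<and> (\<forall>i<r. vec.dim (c ! i) = sum_list (take (Suc i) a))"
    if "a \<in> ?P" for a c
    using that by (intro with_dims_butlast_iff) (simp add: compositions_def)
  have finC: "finite C" using assms(6) finite_multichains finite_subset by metis
  have fin: "finite (?C a)" for a
    using finC by (rule finite_subset[rotated]) (auto simp: with_dims_def)
  have "\<forall>c\<in>C. \<exists>a. a \<in> ?P \<and> c \<in> ?C a"
    using composition_exists assms(2,6) iff by blast
  \<comment> \<open>\<open>T\<close> gives each multichain its dimension type; since the type is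
    unique, the sets \<open>?C a\<close> are the fibres of \<open>T\<close> and partition
    \<open>C\<close>.\<close>
  then obtain T where T: "\<And>c. c \<in> C \<Longrightarrow> T c \<in> ?P \<and> c \<in> ?C (T c)" by metis
  have T_iff: "?C a = {c \<in> C. T c = a}" if a: "a \<in> ?P" for a
  proof (intro equalityI subsetI)
    fix c assume "c \<in> ?C a"
    then show "c \<in> {c \<in> C. T c = a}"
      using composition_unique[OF _ a, of "T c"] T iff a by fastforce
  qed (use T in auto)
  have sum_fibres: "(\<Sum>a\<in>?P. \<Sum>c\<in>?C a. g a) = (\<Sum>c\<in>C. g (T c))" for g :: "nat list \<Rightarrow> real"
  proof -
    have "(\<Sum>a\<in>?P. \<Sum>c\<in>?C a. g a) = (\<Sum>a\<in>?P. \<Sum>c | c \<in> C \<and> T c = a. g (T c))"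
      by (intro sum.cong) (auto simp: T_iff)
    also have "\<dots> = (\<Sum>c\<in>C. g (T c))"
      by (rule sum.group) (use finC finite_compositions T in auto)
    finally show ?thesis .
  qed
  have type: "T c \<in> compositions (r + 1) CARD('n) \<and>
      (\<forall>i<r. vec.dim (c ! i) = sum_list (take (Suc i) (T c)))" if "c \<in> C" for c
    using T[OF that] iff assms(2) by blast
  have "(\<Sum>a\<in>?P. real (card (?C a)) / ?M a) = (\<Sum>c\<in>C. 1 / ?M (T c))"
    by (simp flip: sum_fibres[of "\<lambda>a. 1 / ?M a"])
  also have "\<dots> \<le> real \<tau>"
    unfolding assms(1,2,5)
    by (rule sum_adapted_le[OF assms(6) subset_refl card_adapted_multichains_le type])
      (use assms in auto)
  finally have 1: "(\<Sum>a\<in>?P. real (card (?C a)) / ?M a) \<le> real \<tau>" .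
  \<comment> \<open>Each summand on its own is at most \<open>1\<close>; this is the upper bound on
    the weights in the knapsack argument.\<close>
  have le1: "real (card (?C a)) / ?M a \<le> 1" if a: "a \<in> ?P" for a
  proof -
    have sub: "?C a \<subseteq> C" using T_iff[OF a] by auto
    have len: "length c = r \<and> (\<forall>i<r. vec.dim (c ! i) = sum_list (take (Suc i) a))"
      if "c \<in> ?C a" for c
      using that iff[OF a] assms(6) by (auto simp: multichains_def)
    have "(\<Sum>c\<in>?C a. 1 / q_multinomial CARD('a) CARD('n) (T c)) \<le> real 1"
      by (rule sum_adapted_le[OF assms(6) sub card_adapted_same_dims_le[OF len] type])
        (use sub in auto)
    moreover have "(\<Sum>c\<in>?C a. 1 / ?M (T c)) = (\<Sum>c\<in>?C a. 1 / ?M a)"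
      using T_iff[OF a] by (intro sum.cong) auto
    ultimately show ?thesis by (simp add: assms(1,2))
  qed
  have "real (card C) = (\<Sum>a\<in>?P. real (card (?C a)))"
    using sum_fibres[of "\<lambda>_. 1"] by simp
  \<comment> \<open>The cardinality becomes a weighted sum of multinomial coefficients, with weights
    in \<open>[0, 1]\<close> of total at most \<open>\<tau>\<close>.\<close>
  also have "\<dots> = (\<Sum>a\<in>?P. real (card (?C a)) / ?M a * ?M a)"
    using Mpos by (intro sum.cong) (auto simp: less_imp_neq[THEN not_sym])
  also have "\<dots> \<le> (\<Sum>i<\<tau>. nth_largest (image_mset ?M (mset_set ?P)) i)"
    by (intro sum_weighted_le_sum_nth_largest finite_compositions conjI le1 1 divide_nonneg_nonneg
        less_imp_le[OF Mpos] of_nat_0_le_iff)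
  finally show ?thesis using 1 by blast
qed

end
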